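(* Let $q^{1/2},Q^{1/2}$ be central indeterminates and let $\lambda,\mu$ be variables satisfying $\mu\lambda=q\lambda\mu$ (with $\mu^{-1/2}$ adjoined so that $\lambda\mu^{-1/2}=q^{1/2}\mu^{-1/2}\lambda$). Let $P_T(L,M,x,q)$ be the recurrence polynomial for the colored HOMFLY-PT polynomials of the right-handed trefoil $T$ and let $\widehat{\operatorname{Aug}}_T(\lambda,\mu,Q,q)$ be the quantized augmentation polynomial of $T$ in framing $0$, both given by the explicit formulas in the context. Then the two agree after a change of variables, up to an overall unit: \[ P_T\bigl(q^{-1}Q^{-1}\lambda,\;q^{-1/2}\mu^{-1/2},\;qQ^{1/2},\;q^{1/2}\bigr) \;=\; q^7Q^{-1}\mu^{-6}\, \widehat{\operatorname{Aug}}_T(\lambda,\mu,Q,q). \]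
   Context: The recurrence polynomial $P_T$ is the following element of the algebra over $\mathbb{Q}(q,x)$ generated by $L$ and $M$ subject to $LM=qML$ (with $q,x$ central): \begin{align*} P_T(L,M,x,q)&=x^4(x^2M^2-1)(q^6x^2M^4-1) \\ &\quad +q^7(q^4x^2M^4-1)\bigl(q^8x^4M^8-q^4x^4M^6+q^2x^4M^4+x^4M^4\\ &\qquad\quad -q^6x^2M^4-q^2x^2M^4-x^2M^2+1\bigr) L \\ &\quad -q^{18}x^2M^6(q^4M^2-1)(q^2x^2M^4-1) L^2 . \end{align*} The quantized augmentation polynomial is the following element of the algebra generated by $\lambda,\mu$ with $\mu\lambda=q\lambda\mu$ (with $Q$ and $q^{1/2}$ central): \begin{align*} \widehat{\operatorname{Aug}}_T(\lambda,\mu,Q,q) &= q Q^3 \mu^3(Q-q^{-3}\mu^2)(Q-q^{-1}\mu) \\ &\quad + q^{-5/2}(Q-q^{-2}\mu^2)\bigl((q^2 \mu^2+q^3 \mu^2-q^3 \mu+q^4)Q^2\\ &\qquad\quad -(q\mu^3+q^3\mu^2+q\mu^2)Q+\mu^4\bigr) \lambda \\ &\quad +(Q-q^{-1}\mu^2)(\mu-q)\lambda^2 . \end{align*} In both formulas the powers of $L$ (resp. $\lambda$) are written to the right. The expression $P_T(q^{-1}Q^{-1}\lambda,q^{-1/2}\mu^{-1/2},qQ^{1/2},q^{1/2})$ means: in the formula for $P_T$ substitute $L\mapsto q^{-1}Q^{-1}\lambda$, $M\mapsto q^{-1/2}\mu^{-1/2}$, $x\mapsto qQ^{1/2}$, and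 $q\mapsto q^{1/2}$, where $q$ on the right-hand sides of these substitutions is the variable $q$ of the algebra of $\lambda,\mu$; the relation $LM=qML$ becomes $\lambda\mu^{-1/2}=q^{1/2}\mu^{-1/2}\lambda$, which is compatible with $\mu\lambda=q\lambda\mu$. *)

theory Defs
  imports
    "HOL-Library.Poly_Mapping"
    "HOL-Computational_Algebra.Fraction_Field"
    "HOL-Computational_Algebra.Polynomial"
begin

section \<open>The two polynomials\<close>

text \<open>
  \<open>P_T\<close> is an expression in its four arguments, so that a change of variables is function
  application.  In the algebra of the recurrence polynomial, \<open>L M = q M L\<close> and \<open>q\<close>, \<open>x\<close> are central.
\<close>

definition P_T :: "'a::ring_1 \<Rightarrow> 'a \<Rightarrow> 'a \<Rightarrow> 'a \<Rightarrow> 'a" where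
  "P_T L M x q =
     x^4 * (x^2 * M^2 - 1) * (q^6 * x^2 * M^4 - 1)
     + q^7 * (q^4 * x^2 * M^4 - 1)
         * (q^8 * x^4 * M^8 - q^4 * x^4 * M^6 + q^2 * x^4 * M^4 + x^4 * M^4
            - q^6 * x^2 * M^4 - q^2 * x^2 * M^4 - x^2 * M^2 + 1) * L
     - q^18 * x^2 * M^6 * (q^4 * M^2 - 1) * (q^2 * x^2 * M^4 - 1) * L^2"

text \<open>
  The last argument of \<open>Aug_hat\<close> is \<open>q\<^sup>1\<^sup>/\<^sup>2\<close> and not \<open>q\<close>, because \<open>q\<^sup>-\<^sup>5\<^sup>/\<^sup>2\<close> occurs in the formula.
\<close>

definition Aug_hat :: "'a::{ring_1,inverse} \<Rightarrow> 'a \<Rightarrow> 'a \<Rightarrow> 'a \<Rightarrow> 'a" where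
  "Aug_hat l m Q q_half = (let q = q_half ^ 2 in
     q * Q^3 * m^3 * (Q - q powi (-3) * m^2) * (Q - q powi (-1) * m)
     + q_half powi (-5) * (Q - q powi (-2) * m^2)
         * ((q^2 * m^2 + q^3 * m^2 - q^3 * m + q^4) * Q^2
            - (q * m^3 + q^3 * m^2 + q * m^2) * Q + m^4) * l
     + (Q - q powi (-1) * m^2) * (m - q) * l^2)"

section \<open>The algebra of \<lambda> and \<mu>\<close>

text \<open>
  The field of rational functions over the rationals in two indeterminates, which stand for
  \<open>q\<^sup>1\<^sup>/\<^sup>2\<close> (\<open>s_coeff\<close>) and \<open>Q\<^sup>1\<^sup>/\<^sup>2\<close> (\<open>t_coeff\<close>).
\<close>

type_synonym coeff = "rat poly poly fract"

definition s_coeff :: coeff where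
  "s_coeff = Fraction_Field.Fract [:[:0, 1:]:] 1"

definition t_coeff :: coeff where
  "t_coeff = Fraction_Field.Fract [:0, 1:] 1"

lemma s_coeff_nonzero [simp]: "s_coeff \<noteq> 0"
  by (simp add: s_coeff_def Zero_fract_def Fraction_Field.eq_fract)

lemma t_coeff_nonzero [simp]: "t_coeff \<noteq> 0"
  by (simp add: t_coeff_def Zero_fract_def Fraction_Field.eq_fract)

text \<open>
  An element of the algebra is a finite sum of terms \<open>c \<mu>\<^sup>i\<^sup>/\<^sup>2 \<lambda>\<^sup>j\<close> with \<open>c\<close> in the coefficient
  field, \<open>i\<close> an integer and \<open>j\<close> a natural number: its value at \<open>(i, j)\<close> is the coefficient \<open>c\<close>.
  So \<open>\<mu>\<^sup>1\<^sup>/\<^sup>2\<close> is invertible and \<open>\<lambda>\<close> is not.  From \<open>\<lambda> \<mu>\<^sup>1\<^sup>/\<^sup>2 = q\<^sup>-\<^sup>1\<^sup>/\<^sup>2 \<mu>\<^sup>1\<^sup>/\<^sup>2 \<lambda>\<close> one gets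
  \<open>\<lambda>\<^sup>j \<mu>\<^sup>k\<^sup>/\<^sup>2 = q\<^sup>-\<^sup>j\<^sup>k\<^sup>/\<^sup>2 \<mu>\<^sup>k\<^sup>/\<^sup>2 \<lambda>\<^sup>j\<close>, which is the factor \<open>twist\<close> in the product of two monomials.
\<close>

typedef qalg = "UNIV :: (int \<times> nat \<Rightarrow>\<^sub>0 coeff) set"
  morphisms coeffs of_coeffs ..

setup_lifting type_definition_qalg

definition exp_add :: "int \<times> nat \<Rightarrow> int \<times> nat \<Rightarrow> int \<times> nat" where
  "exp_add a b = (fst a + fst b, snd a + snd b)"

definition twist :: "int \<times> nat \<Rightarrow> int \<times> nat \<Rightarrow> coeff" where
  "twist a b = s_coeff powi (- (int (snd a) * fst b))"

definition qmult :: "(int \<times> nat \<Rightarrow>\<^sub>0 coeff) \<Rightarrow> (int \<times> nat \<Rightarrow>\<^sub>0 coeff) \<Rightarrow> (int \<times> nat \<Rightarrow>\<^sub>0 coeff)" where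
  "qmult f g =
     (\<Sum>a\<in>Poly_Mapping.keys f. \<Sum>b\<in>Poly_Mapping.keys g.
        Poly_Mapping.single (exp_add a b)
          (twist a b * Poly_Mapping.lookup f a * Poly_Mapping.lookup g b))"

lemma qmult_superset:
  assumes "finite A" "Poly_Mapping.keys f \<subseteq> A" "finite B" "Poly_Mapping.keys g \<subseteq> B"
  shows "qmult f g =
     (\<Sum>a\<in>A. \<Sum>b\<in>B. Poly_Mapping.single (exp_add a b)
          (twist a b * Poly_Mapping.lookup f a * Poly_Mapping.lookup g b))"
proof -
  have inner: "(\<Sum>b\<in>Poly_Mapping.keys g. Poly_Mapping.single (exp_add a b)
          (twist a b * Poly_Mapping.lookup f a * Poly_Mapping.lookup g b)) =
      (\<Sum>b\<in>B. Poly_Mapping.single (exp_add a b)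
          (twist a b * Poly_Mapping.lookup f a * Poly_Mapping.lookup g b))" for a
    by (rule sum.mono_neutral_left) (use assms in \<open>auto simp: in_keys_iff\<close>)
  show ?thesis
    unfolding qmult_def inner
    by (rule sum.mono_neutral_left) (use assms in \<open>auto simp: in_keys_iff\<close>)
qed

lemma qmult_add_left: "qmult (f + f') g = qmult f g + qmult f' g"
proof -
  let ?A = "Poly_Mapping.keys f \<union> Poly_Mapping.keys f'"
  let ?B = "Poly_Mapping.keys g"
  show ?thesis
    using keys_add[of f f']
    by (simp add: qmult_superset[of ?A _ ?B] lookup_add distrib_left distrib_right single_add
        sum.distrib)
qed

lemma qmult_add_right: "qmult f (g + g') = qmult f g + qmult f g'"
proof -
  let ?A = "Poly_Mapping.keys f"
  let ?B = "Poly_Mapping.keys g \<union> Poly_Mapping.keys g'"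
  show ?thesis
    using keys_add[of g g']
    by (simp add: qmult_superset[of ?A _ ?B] lookup_add distrib_left distrib_right single_add
        sum.distrib)
qed

lemma qmult_zero_left [simp]: "qmult 0 g = 0"
  by (simp add: qmult_def)

lemma qmult_zero_right [simp]: "qmult f 0 = 0"
  by (simp add: qmult_def)

lemma qmult_single:
  "qmult (Poly_Mapping.single a c) (Poly_Mapping.single b d) =
     Poly_Mapping.single (exp_add a b) (twist a b * c * d)"
  by (subst qmult_superset[of "{a}" _ "{b}"]) auto

lemma single_additive_induct:
  fixes f :: "'k \<Rightarrow>\<^sub>0 'c::comm_monoid_add"
  assumes "P 0" "\<And>k c. P (Poly_Mapping.single k c)" "\<And>f g. P f \<Longrightarrow> P g \<Longrightarrow> P (f + g)"
  shows "P f"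
proof (induction f rule: update_induct)
  case const
  show ?case by (fact assms(1))
next
  case (update f k c)
  have "Poly_Mapping.update k c f = f + Poly_Mapping.single k c"
    using update(1) by (intro poly_mapping_eqI)
      (auto simp: lookup_update lookup_add lookup_single when_def in_keys_iff)
  then show ?case using update assms by simp
qed

lemma twist_cocycle:
  "twist (exp_add a b) c * twist a b = twist a (exp_add b c) * twist b c"
  by (simp add: twist_def exp_add_def power_int_add[symmetric] algebra_simps)

lemma exp_add_assoc: "exp_add (exp_add a b) c = exp_add a (exp_add b c)"
  by (simp add: exp_add_def)

lemma qmult_assoc: "qmult (qmult f g) h = qmult f (qmult g h)"
proof (induction f rule: single_additive_induct)
  case (2 a u)
  show ?case
  proof (induction g rule: single_additive_induct)
    case (2 b v)
    show ?case
    proof (induction h rule: single_additive_induct)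
      case (2 c w)
      show ?case
        using twist_cocycle[of a b c]
        by (simp add: qmult_single exp_add_assoc mult_ac)
    qed (simp_all add: qmult_add_right)
  qed (simp_all add: qmult_add_left qmult_add_right)
qed (simp_all add: qmult_add_left)

lemma qmult_one_left: "qmult (Poly_Mapping.single (0, 0) 1) f = f"
  by (induction f rule: single_additive_induct)
    (simp_all add: qmult_single qmult_add_right exp_add_def twist_def)

lemma qmult_one_right: "qmult f (Poly_Mapping.single (0, 0) 1) = f"
  by (induction f rule: single_additive_induct)
    (simp_all add: qmult_single qmult_add_left exp_add_def twist_def)

instantiation qalg :: ring_1
begin

lift_definition zero_qalg :: qalg is 0 .
lift_definition one_qalg :: qalg is "Poly_Mapping.single (0, 0) 1" .
lift_definition plus_qalg :: "qalg \<Rightarrow> qalg \<Rightarrow> qalg" is "(+)" .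
lift_definition minus_qalg :: "qalg \<Rightarrow> qalg \<Rightarrow> qalg" is "(-)" .
lift_definition uminus_qalg :: "qalg \<Rightarrow> qalg" is uminus .
lift_definition times_qalg :: "qalg \<Rightarrow> qalg \<Rightarrow> qalg" is qmult .

instance
proof
  show "(0::qalg) \<noteq> 1"
    by transfer (metis lookup_single_eq lookup_zero zero_neq_one)
qed (transfer; simp add: qmult_assoc qmult_add_left qmult_add_right qmult_one_left
    qmult_one_right algebra_simps)+

end

text \<open>The inverse is the two-sided inverse of a unit; it is 0 on all other elements.\<close>

instantiation qalg :: inverse
begin

definition inverse_qalg :: "qalg \<Rightarrow> qalg" where
  "inverse_qalg x =
     (if \<exists>y. x * y = 1 \<and> y * x = 1 then THE y. x * y = 1 \<and> y * x = 1 else 0)"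

definition divide_qalg :: "qalg \<Rightarrow> qalg \<Rightarrow> qalg" where
  "divide_qalg x y = x * inverse y"

instance ..

end

lemma inverse_qalg_eqI:
  fixes x y :: qalg
  assumes "x * y = 1" "y * x = 1"
  shows "inverse x = y"
proof -
  have "(THE y. x * y = 1 \<and> y * x = 1) = y"
  proof (rule the_equality)
    fix z assume z: "x * z = 1 \<and> z * x = 1"
    have "z = (y * x) * z" using assms by simp
    also have "\<dots> = y * (x * z)" by (simp add: mult.assoc)
    finally show "z = y" using z by simp
  qed (use assms in simp)
  then show ?thesis using assms by (auto simp: inverse_qalg_def)
qed

definition scalar :: "coeff \<Rightarrow> qalg" where
  "scalar c = of_coeffs (Poly_Mapping.single (0, 0) c)"

definition q_half :: qalg where "q_half = scalar s_coeff"
definition Q_half :: qalg where "Q_half = scalar t_coeff"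
definition mu_half :: qalg where "mu_half = of_coeffs (Poly_Mapping.single (1, 0) 1)"
definition lam :: qalg where "lam = of_coeffs (Poly_Mapping.single (0, 1) 1)"

definition q :: qalg where "q = q_half ^ 2"
definition Q :: qalg where "Q = Q_half ^ 2"
definition mu :: qalg where "mu = mu_half ^ 2"

lemma of_coeffs_mult: "of_coeffs f * of_coeffs g = of_coeffs (qmult f g)"
  by (simp add: times_qalg.abs_eq)

lemma one_qalg_eq: "(1::qalg) = of_coeffs (Poly_Mapping.single (0, 0) 1)"
  by (simp add: one_qalg.abs_eq)

lemma scalar_central: "scalar c * x = x * scalar c"
proof -
  have "qmult (Poly_Mapping.single (0, 0) c) f = qmult f (Poly_Mapping.single (0, 0) c)" for f
    by (induction f rule: single_additive_induct)
      (simp_all add: qmult_single qmult_add_left qmult_add_right exp_add_def twist_def mult.commute)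
  then show ?thesis
    by (cases x) (simp add: scalar_def of_coeffs_mult)
qed

lemma scalar_mult: "scalar c * scalar d = scalar (c * d)"
  by (simp add: scalar_def of_coeffs_mult qmult_single exp_add_def twist_def)

lemma inverse_scalar:
  assumes "c \<noteq> 0"
  shows "inverse (scalar c) = scalar (inverse c)"
  by (rule inverse_qalg_eqI) (use assms in \<open>simp_all add: scalar_mult, simp_all add: scalar_def one_qalg_eq\<close>)

lemma inverse_mu_half: "inverse mu_half = of_coeffs (Poly_Mapping.single (-1, 0) 1)"
  by (rule inverse_qalg_eqI)
    (simp_all add: mu_half_def of_coeffs_mult qmult_single exp_add_def twist_def one_qalg_eq)

lemma lam_inverse_mu_half: "lam * inverse mu_half = q_half * inverse mu_half * lam"
  by (simp add: inverse_mu_half lam_def q_half_def scalar_def of_coeffs_mult qmult_single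
      exp_add_def twist_def)

lemma mu_lam: "mu * lam = q * lam * mu"
  by (simp add: mu_def lam_def mu_half_def q_def q_half_def scalar_def of_coeffs_mult qmult_single
      exp_add_def twist_def power2_eq_square power_int_minus field_simps)

end

theory Submission
  imports Defs
begin

text \<open>
  Both sides are polynomials in \<open>\<lambda>\<close> of degree 2 with coefficients on the left.  These coefficients lie
  in the commutative subalgebra of Laurent polynomials in \<open>\<mu>\<^sup>1\<^sup>/\<^sup>2\<close>.  This subalgebra is the image of a
  ring homomorphism from the type of finitely supported functions on the integers, which is an integral
  domain, so that the three coefficient identities are checked there.
\<close>

lemma qalg_powi_neg: "(x::qalg) powi (- numeral n) = inverse x ^ numeral n"
  by (simp add: power_int_def)

lemma qalg_powi_neg1: "(x::qalg) powi (- 1) = inverse x"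
  by (simp add: power_int_def)

definition laurent :: "(int \<Rightarrow>\<^sub>0 coeff) \<Rightarrow> qalg" where
  "laurent f = (\<Sum>i\<in>Poly_Mapping.keys f. of_coeffs (Poly_Mapping.single (i, 0) (Poly_Mapping.lookup f i)))"

lemma of_coeffs_add: "of_coeffs (f + g) = of_coeffs f + of_coeffs g"
  by (simp add: plus_qalg.abs_eq)

lemma of_coeffs_zero: "of_coeffs 0 = 0"
  by (simp add: zero_qalg_def)

lemma laurent_zero: "laurent 0 = 0"
  by (simp add: laurent_def)

lemma laurent_single: "laurent (Poly_Mapping.single i c) = of_coeffs (Poly_Mapping.single (i, 0) c)"
  by (simp add: laurent_def of_coeffs_zero)

lemma laurent_add: "laurent (f + g) = laurent f + laurent g"
  unfolding laurent_def
  by (rule Poly_Mapping.setsum_keys_plus_distrib) (simp_all add: of_coeffs_zero single_add of_coeffs_add)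

lemma laurent_minus: "laurent (f - g) = laurent f - laurent g"
  using laurent_add[of "f - g" g] by simp

lemma laurent_one: "laurent 1 = 1"
  by (simp add: one_qalg_eq laurent_single flip: single_one)

text \<open>The exponent in \<open>twist\<close> contains the \<lambda>-degree of the left factor,
  which is 0 here; additivity in both arguments reduces the claim to monomials.\<close>

lemma laurent_mult: "laurent (f * g) = laurent f * laurent g"
proof (induction f rule: single_additive_induct)
  case (2 a u)
  show ?case
  proof (induction g rule: single_additive_induct)
    case (2 b v)
    show ?case
      by (simp add: mult_single laurent_single of_coeffs_mult qmult_single exp_add_def twist_def)
  qed (simp_all add: laurent_zero laurent_add distrib_left)
qed (simp_all add: laurent_zero laurent_add distrib_right)

lemma laurent_power: "laurent (f ^ n) = laurent f ^ n"
  by (induction n) (simp_all add: laurent_one laurent_mult)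

lemma laurent_uminus: "laurent (- f) = - laurent f"
  using laurent_minus[of 0 f] by (simp add: laurent_zero)

lemmas laurent_hom = laurent_one laurent_add laurent_minus laurent_uminus laurent_mult laurent_power

text \<open>
  Here \<open>s\<close>, \<open>t\<close>, \<open>m\<close> stand for \<open>q\<^sup>1\<^sup>/\<^sup>2\<close>, \<open>Q\<^sup>1\<^sup>/\<^sup>2\<close>, \<open>\<mu>\<^sup>1\<^sup>/\<^sup>2\<close> and \<open>s'\<close>, \<open>t'\<close>, \<open>n\<close> for their
  inverses; the factor \<open>s^14 * t'^2 * n^12\<close> is the unit \<open>q\<^sup>7 Q\<^sup>-\<^sup>1 \<mu>\<^sup>-\<^sup>6\<close>.  The proof inserts products of
  mutually inverse powers until both sides agree as polynomials.
\<close>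

lemma trefoil_coefficient_identities:
  fixes s s' t t' m n :: "'a::idom"
  assumes s: "s * s' = 1" and t: "t * t' = 1" and m: "m * n = 1"
  defines "x \<equiv> s^2 * t" and "M \<equiv> s' * n"
  shows "x^4 * (x^2 * M^2 - 1) * (s^6 * x^2 * M^4 - 1)
      = s^14 * t'^2 * n^12 * (s^2 * (t^2)^3 * (m^2)^3 * (t^2 - s'^6 * (m^2)^2) * (t^2 - s'^2 * m^2))"
      (is ?constant)
    and "s^7 * (s^4 * x^2 * M^4 - 1)
         * (s^8 * x^4 * M^8 - s^4 * x^4 * M^6 + s^2 * x^4 * M^4 + x^4 * M^4
            - s^6 * x^2 * M^4 - s^2 * x^2 * M^4 - x^2 * M^2 + 1) * (s'^2 * t'^2)
      = s^14 * t'^2 * n^12 * (s'^5 * (t^2 - s'^4 * (m^2)^2)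
         * (((s^2)^2 * (m^2)^2 + (s^2)^3 * (m^2)^2 - (s^2)^3 * m^2 + (s^2)^4) * (t^2)^2
            - (s^2 * (m^2)^3 + (s^2)^3 * (m^2)^2 + s^2 * (m^2)^2) * t^2 + (m^2)^4))"
      (is ?linear)
    and "- (s^18 * x^2 * M^6 * (s^4 * M^2 - 1) * (s^2 * x^2 * M^4 - 1) * (s'^2 * t'^2)^2)
      = s^14 * t'^2 * n^12 * ((t^2 - s'^2 * (m^2)^2) * (m^2 - s^2))"
      (is ?quadratic)
proof -
  have inv: "s^k * s'^k = 1" "t^k * t'^k = 1" "m^k * n^k = 1" for k
    using assms(1-3) by (simp_all flip: power_mult_distrib)
  have x4: "x^4 = s^8 * t^4"
    by (simp add: x_def power_mult_distrib flip: power_mult)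
  \<comment> \<open>Each \<open>x\<close> brings \<open>s^2\<close> and each \<open>M\<close> brings
    \<open>s'\<close>, so that \<open>s'\<close> cancels from this product and the next
    ones.\<close>
  have xM2: "x^2 * M^2 = s^2 * t^2 * n^2"
  proof -
    have "x^2 * M^2 = (s^2 * s'^2) * (s^2 * t^2 * n^2)" unfolding x_def M_def by algebra
    then show ?thesis by (simp add: inv)
  qed
  have xM4: "x^2 * M^4 = t^2 * n^4"
  proof -
    have "x^2 * M^4 = (s^4 * s'^4) * (t^2 * n^4)" unfolding x_def M_def by algebra
    then show ?thesis by (simp add: inv)
  qed
  have s4M2: "s^4 * M^2 = s^2 * n^2"
  proof -
    have "s^4 * M^2 = (s^2 * s'^2) * (s^2 * n^2)" unfolding M_def by algebra
    then show ?thesis by (simp add: inv)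
  qed
  have x4M4: "x^4 * M^4 = s^4 * t^4 * n^4"
  proof -
    have "x^4 * M^4 = (x^2 * M^2)^2" by algebra
    then show ?thesis unfolding xM2 by algebra
  qed
  have x4M6: "x^4 * M^6 = s^2 * t^4 * n^6"
  proof -
    have "x^4 * M^6 = (x^2 * M^2) * (x^2 * M^4)" by algebra
    then show ?thesis unfolding xM2 xM4 by algebra
  qed
  have x4M8: "x^4 * M^8 = t^4 * n^8"
  proof -
    have "x^4 * M^8 = (x^2 * M^4)^2" by algebra
    then show ?thesis unfolding xM4 by algebra
  qed
  \<comment> \<open>Turns the binomials with leading term \<open>Q\<close> on the augmentation side
    into unit multiples of the binomials in \<open>P_T\<close>.\<close>
  have fac: "t^2 - s'^k * m^j = s'^k * m^j * (s^k * t^2 * n^j - 1)" for k j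
  proof -
    have "s'^k * m^j * (s^k * t^2 * n^j - 1) = (s^k * s'^k) * (m^j * n^j) * t^2 - s'^k * m^j"
      by (simp add: algebra_simps)
    then show ?thesis by (simp add: inv)
  qed
  have mm: "(m^2)^2 = m^4" by algebra

  have "x^4 * (x^2 * M^2 - 1) * (s^6 * x^2 * M^4 - 1)
      = s^8 * t^4 * (s^2 * t^2 * n^2 - 1) * (s^6 * t^2 * n^4 - 1)"
    unfolding mult.assoc[of _ "x^2"] xM2 xM4 x4 by (simp add: mult.assoc)
  \<comment> \<open>The exponents compare the units outside the binomials: the target has
    \<open>s^16 * s'^8 * t^6 * t'^2 * m^12 * n^12\<close>, the present side
    \<open>s^8 * t^4\<close>.\<close>
  also have "\<dots> = (s^8 * s'^8) * (t^2 * t'^2) * (m^12 * n^12)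
      * (s^8 * t^4 * (s^2 * t^2 * n^2 - 1) * (s^6 * t^2 * n^4 - 1))"
    by (simp add: inv)
  also have "\<dots> = s^14 * t'^2 * n^12 * (s^2 * (t^2)^3 * (m^2)^3
      * (s'^6 * m^4 * (s^6 * t^2 * n^4 - 1)) * (s'^2 * m^2 * (s^2 * t^2 * n^2 - 1)))"
    by algebra
  finally show ?constant by (simp only: fac mm)

  have "s^7 * (s^4 * x^2 * M^4 - 1)
         * (s^8 * x^4 * M^8 - s^4 * x^4 * M^6 + s^2 * x^4 * M^4 + x^4 * M^4
            - s^6 * x^2 * M^4 - s^2 * x^2 * M^4 - x^2 * M^2 + 1) * (s'^2 * t'^2)
      = s^7 * (s^4 * t^2 * n^4 - 1)
         * (s^8 * t^4 * n^8 - s^6 * t^4 * n^6 + s^6 * t^4 * n^4 + s^4 * t^4 * n^4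
            - s^6 * t^2 * n^4 - s^2 * t^2 * n^4 - s^2 * t^2 * n^2 + 1) * (s'^2 * t'^2)"
    unfolding mult.assoc[of _ "x^2"] mult.assoc[of _ "x^4"] xM2 xM4 x4M4 x4M6 x4M8
    by (simp flip: mult.assoc power_add)
  \<comment> \<open>Every monomial of the long factor is padded to degree 8 in \<open>n\<close>, the
    constant 1 becoming \<open>m^8 * n^8\<close>; then \<open>n^8\<close> comes out and the
    quadratic in \<open>Q\<close> remains.\<close>
  also have "\<dots> = s^7 * s'^2 * t'^2 * (s^4 * t^2 * n^4 - 1)
         * ((s^8 * n^8 - s^6 * (m^2 * n^2) * n^6 + s^6 * (m^4 * n^4) * n^4 + s^4 * (m^4 * n^4) * n^4) * t^4
            - (s^6 * (m^4 * n^4) * n^4 + s^2 * (m^4 * n^4) * n^4 + s^2 * (m^6 * n^6) * n^2) * t^2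
            + m^8 * n^8)"
    unfolding inv by algebra
  also have "\<dots> = s^7 * s'^2 * t'^2 * n^8 * (s^4 * t^2 * n^4 - 1)
      * (((s^2)^2 * (m^2)^2 + (s^2)^3 * (m^2)^2 - (s^2)^3 * m^2 + (s^2)^4) * (t^2)^2
            - (s^2 * (m^2)^3 + (s^2)^3 * (m^2)^2 + s^2 * (m^2)^2) * t^2 + (m^2)^4)"
    (is "_ = _ * _ * _ * _ * _ * ?I") by algebra
  also have "\<dots> = (s^7 * s'^7) * (m^4 * n^4)
      * (s^7 * s'^2 * t'^2 * n^8 * (s^4 * t^2 * n^4 - 1) * ?I)"
    by (simp add: inv)
  also have "\<dots> = s^14 * t'^2 * n^12 * (s'^5 * (s'^4 * m^4 * (s^4 * t^2 * n^4 - 1)) * ?I)"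
    by algebra
  finally show ?linear by (simp only: fac mm)

  have "- (s^18 * x^2 * M^6 * (s^4 * M^2 - 1) * (s^2 * x^2 * M^4 - 1) * (s'^2 * t'^2)^2)
      = - (s^14 * (x^2 * M^4) * (s^4 * M^2) * (s^4 * M^2 - 1) * (s^2 * (x^2 * M^4) - 1) * (s'^2 * t'^2)^2)"
    by algebra
  also have "\<dots> = (t^2 * t'^2) * (s^4 * s'^4)
      * (s^12 * t'^2 * n^6 * (1 - s^2 * n^2) * (s^2 * t^2 * n^4 - 1))"
    unfolding xM4 s4M2 by algebra
  \<comment> \<open>The 1 in \<open>1 - s^2 * n^2\<close>, which has absorbed the sign, is written
    as \<open>m^2 * n^2\<close>, so that \<open>n^2 * (m^2 - s^2)\<close> appears.\<close>
  also have "\<dots> = (s^2 * s'^2) * (m^4 * n^4)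
      * (s^12 * t'^2 * n^6 * (m^2 * n^2 - s^2 * n^2) * (s^2 * t^2 * n^4 - 1))"
    by (simp add: inv)
  also have "\<dots> = s^14 * t'^2 * n^12 * ((s'^2 * m^4 * (s^2 * t^2 * n^4 - 1)) * (m^2 - s^2))"
    by algebra
  finally show ?quadratic by (simp only: fac mm)
qed

text \<open>Needed for \<open>L^2\<close>: the factor in front of \<lambda> is central, so squaring
  produces no power of \<open>q\<close> from reordering.\<close>

lemma scaled_square: "(scalar c * y)^2 = scalar (c^2) * y^2"
  by (simp add: power2_eq_square mult.assoc flip: scalar_mult) (metis mult.assoc scalar_central)

theorem proposition7p4:
  shows "P_T (q powi (-1) * Q powi (-1) * lam) (q_half powi (-1) * mu_half powi (-1))
             (q * Q_half) q_half
         = q^7 * Q powi (-1) * mu powi (-6) * Aug_hat lam mu Q q_half"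
proof -
  define s s' t t' m n :: "int \<Rightarrow>\<^sub>0 coeff" where
    "s = Poly_Mapping.single 0 s_coeff" and "s' = Poly_Mapping.single 0 (inverse s_coeff)" and
    "t = Poly_Mapping.single 0 t_coeff" and "t' = Poly_Mapping.single 0 (inverse t_coeff)" and
    "m = Poly_Mapping.single 1 1" and "n = Poly_Mapping.single (- 1) 1"
  note defs = s_def s'_def t_def t'_def m_def n_def
  have units: "s * s' = 1" "t * t' = 1" "m * n = 1"
    by (simp_all add: defs mult_single)
  have gen: "q_half = laurent s" "Q_half = laurent t" "mu_half = laurent m"
    by (simp_all add: defs laurent_single q_half_def Q_half_def mu_half_def scalar_def)
  \<comment> \<open>\<open>inverse\<close> is 0 off the units, so each negative power requires an
    explicit two-sided inverse, supplied by the commutative ring.\<close>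
  have inv_laurent: "inverse (laurent f) = laurent g" if "f * g = 1" for f g
    using that by (intro inverse_qalg_eqI) (simp_all add: laurent_one mult.commute flip: laurent_mult)
  have inv_pow: "inverse (laurent (f ^ k)) = laurent (g ^ k)" if "f * g = 1" for f g k
    using that by (intro inv_laurent) (simp flip: power_mult_distrib)
  have invs: "inverse (laurent s) = laurent s'" "inverse (laurent m) = laurent n"
    "inverse (laurent (s^2)) = laurent (s'^2)" "inverse (laurent (t^2)) = laurent (t'^2)"
    "inverse (laurent (m^2)) = laurent (n^2)"
    by (intro inv_laurent inv_pow units)+
  have L: "q powi (-1) * Q powi (-1) * lam = laurent (s'^2 * t'^2) * lam"
    by (simp add: q_def Q_def gen qalg_powi_neg1 invs laurent_mult flip: laurent_power)
  have L2: "(laurent (s'^2 * t'^2) * lam)^2 = laurent ((s'^2 * t'^2)^2) * lam^2"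
  proof -
    have "laurent (s'^2 * t'^2) = scalar (inverse s_coeff ^ 2 * inverse t_coeff ^ 2)"
      by (simp add: defs power2_eq_square mult_single laurent_single scalar_def)
    then show ?thesis
      by (simp only: scaled_square laurent_power) (simp add: power2_eq_square scalar_mult)
  qed
  have Aug: "Aug_hat lam mu Q q_half
      = laurent (s^2 * (t^2)^3 * (m^2)^3 * (t^2 - s'^6 * (m^2)^2) * (t^2 - s'^2 * m^2))
        + laurent (s'^5 * (t^2 - s'^4 * (m^2)^2)
         * (((s^2)^2 * (m^2)^2 + (s^2)^3 * (m^2)^2 - (s^2)^3 * m^2 + (s^2)^4) * (t^2)^2
            - (s^2 * (m^2)^3 + (s^2)^3 * (m^2)^2 + s^2 * (m^2)^2) * t^2 + (m^2)^4)) * lam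
        + laurent ((t^2 - s'^2 * (m^2)^2) * (m^2 - s^2)) * lam^2"
    unfolding Aug_hat_def Let_def mu_def Q_def gen qalg_powi_neg qalg_powi_neg1
      laurent_power[of _ 2, symmetric] invs
    by (simp add: laurent_hom mult.assoc flip: power_mult)
  define x M where "x = s^2 * t" and "M = s' * n"
  have args: "q * Q_half = laurent x" "q_half powi (-1) * mu_half powi (-1) = laurent M"
    by (simp_all add: x_def M_def q_def gen qalg_powi_neg1 invs laurent_mult laurent_power)
  \<comment> \<open>Powers of \<open>L\<close> stand rightmost, so the scalar from \<open>L\<close>
    or \<open>L^2\<close> joins the Laurent coefficient to its left.\<close>
  have "P_T (laurent (s'^2 * t'^2) * lam) (laurent M) (laurent x) (laurent s)
      = laurent (x^4 * (x^2 * M^2 - 1) * (s^6 * x^2 * M^4 - 1))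
        + laurent (s^7 * (s^4 * x^2 * M^4 - 1)
         * (s^8 * x^4 * M^8 - s^4 * x^4 * M^6 + s^2 * x^4 * M^4 + x^4 * M^4
            - s^6 * x^2 * M^4 - s^2 * x^2 * M^4 - x^2 * M^2 + 1) * (s'^2 * t'^2)) * lam
        + laurent (- (s^18 * x^2 * M^6 * (s^4 * M^2 - 1) * (s^2 * x^2 * M^4 - 1) * (s'^2 * t'^2)^2))
          * lam^2"
    unfolding P_T_def L2 by (simp add: laurent_hom mult.assoc)
  also have "\<dots> = laurent (s^14 * t'^2 * n^12) * Aug_hat lam mu Q q_half"
    (is "_ = laurent ?unit * _")
    unfolding trefoil_coefficient_identities[OF units, folded x_def M_def] Aug
    by (simp only: laurent_mult[of ?unit] distrib_left[of "laurent ?unit"]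
        mult.assoc[of "laurent ?unit"])
  also have "laurent (s^14 * t'^2 * n^12) = q^7 * Q powi (-1) * mu powi (-6)"
    by (simp add: q_def Q_def mu_def gen qalg_powi_neg qalg_powi_neg1 invs laurent_mult
        flip: laurent_power power_mult)
  finally show ?thesis by (simp only: L args flip: gen(1))
qed

end
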